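(* Let $k,d$ be non-negative integers, not both $0$, and let $S \subset \mathbb{Z}^k\times\mathbb{N}^d$. For $1\le i\le k$, let $S_i$ be the $i$-th central compression of $S$. Then $|\partial S_i| \le |\partial S|$. Similarly, for $k+1\le j\le k+d$, let $S_j$ be the $j$-th downward compression of $S$. Then $|\partial S_j|\le|\partial S|$.
   Context: $\mathbb{N} = \{x\in\mathbb{Z} : x \ge 0\}$. For $S \subset \mathbb{Z}^k\times\mathbb{N}^d$, $\partial S = \{x \in \mathbb{Z}^k\times\mathbb{N}^d : \|x-y\|_\infty \le 1 \text{ for some } y \in S\}$, where $\|x\|_\infty=\max_i|x_i|$. For a vector $p=(p_1,\dots,p_n)$ and a number $x$, $(p, x\to i) = (p_1,\dots,p_{i-1},x,p_i,\dots,p_n)$, i.e. $x$ is inserted as the $i$-th coordinate. Central compression. For $1\le i\le k$ and $p\in\mathbb{Z}^{k-1}\times\mathbb{N}^d$, a set $T\subset\mathbb{Z}^k\times\mathbb{N}^d$ is centrally compressed in the $i$-th coordinate with respect to $p$ if $\{x\in\mathbb{Z} : (p,x\to i)\in T\}$ is either empty, or of the form $\{x\in\mathbb{Z}: -a\le x\le a\}$ for some $a\in\mathbb{N}$, or of the form $\{x\in\mathbb{Z}: -a\le x\le a+1\}$ for some $a\in\mathbb{N}$. The $i$-th central compression $S_i$ of $S$ is the set $S_i\subset\mathbb{Z}^k\times\mathbb{N}^d$ such that for every $p\in\mathbb{Z}^{k-1}\times\mathbb{N}^d$: $|\{x\in\mathbb{Z}:(p,x\to i)\in S_i\}| = |\{x\in\mathbb{Z}:(p,x\to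 i)\in S\}|$, and $S_i$ is centrally compressed in the $i$-th coordinate with respect to $p$. Downward compression. For $k+1\le j\le k+d$ and $p\in\mathbb{Z}^k\times\mathbb{N}^{d-1}$, a set $T$ is downward compressed in the $j$-th coordinate with respect to $p$ if $\{x\in\mathbb{N} : (p,x\to j)\in T\}$ is either empty or of the form $\{x: 0\le x\le a\}$ for some $a\in\mathbb{N}$. The $j$-th downward compression $S_j$ of $S$ is the set $S_j\subset\mathbb{Z}^k\times\mathbb{N}^d$ such that for every $p\in\mathbb{Z}^k\times\mathbb{N}^{d-1}$: $|\{x\in\mathbb{N}:(p,x\to j)\in S_j\}| = |\{x\in\mathbb{N}:(p,x\to j)\in S\}|$, and $S_j$ is downward compressed in the $j$-th coordinate with respect to $p$. The compression in a given coordinate is defined (and then unique) precisely when all the one-dimensional sections of $S$ in that coordinate direction are finite, for instance when $S$ is finite; the statement is about those $S_i$, $S_j$ that are defined. *)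

theory Defs
  imports Main "HOL-Library.Equipollence"
begin

text \<open>
  Vectors are lists of integers, and \<open>\<nat>\<close> is the set of non-negative integers inside \<open>\<int>\<close>.
  So \<open>ZN k d\<close> is \<open>\<int>\<^sup>k \<times> \<nat>\<^sup>d\<close>: the list positions \<open>k, \<dots>, k + d - 1\<close>, i.e. the coordinates
  number \<open>k + 1, \<dots>, k + d\<close>, carry non-negative entries.
\<close>

definition ZN :: "nat \<Rightarrow> nat \<Rightarrow> int list set" where
  "ZN k d = {x. length x = k + d \<and> (\<forall>j. k \<le> j \<and> j < k + d \<longrightarrow> 0 \<le> x ! j)}"

text \<open>Only meaningful for non-empty lists, since \<open>Max {}\<close> is unspecified.\<close>

definition linf_norm :: "int list \<Rightarrow> int" where
  "linf_norm x = Max (abs ` set x)"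

definition boundary :: "nat \<Rightarrow> nat \<Rightarrow> int list set \<Rightarrow> int list set" where
  "boundary k d S = {x \<in> ZN k d. \<exists>y\<in>S. linf_norm (map2 (-) x y) \<le> 1}"

text \<open>\<open>insert_coord p x i\<close> is \<open>(p, x \<rightarrow> i)\<close>; coordinates are numbered from 1.\<close>

definition insert_coord :: "int list \<Rightarrow> int \<Rightarrow> nat \<Rightarrow> int list" where
  "insert_coord p x i = take (i - 1) p @ x # drop (i - 1) p"

definition centrally_compressed :: "nat \<Rightarrow> int list \<Rightarrow> int list set \<Rightarrow> bool" where
  "centrally_compressed i p T \<longleftrightarrow>
     {x. insert_coord p x i \<in> T} = {} \<or>
     (\<exists>a\<ge>0. {x. insert_coord p x i \<in> T} = {- a..a}) \<or>
     (\<exists>a\<ge>0. {x. insert_coord p x i \<in> T} = {- a..a + 1})"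

definition downward_compressed :: "nat \<Rightarrow> int list \<Rightarrow> int list set \<Rightarrow> bool" where
  "downward_compressed j p T \<longleftrightarrow>
     {x. 0 \<le> x \<and> insert_coord p x j \<in> T} = {} \<or>
     (\<exists>a\<ge>0. {x. 0 \<le> x \<and> insert_coord p x j \<in> T} = {0..a})"

text \<open>
  A compression is given as a relation between \<open>S\<close> and the compressed set \<open>T\<close>, because it
  exists (and is then unique) only if the one-dimensional sections of \<open>S\<close> in the given direction
  are finite. Sizes are compared by equipollence, as \<open>card\<close> would identify infinite sections
  with empty ones.
\<close>

definition is_central_compression ::
    "nat \<Rightarrow> nat \<Rightarrow> nat \<Rightarrow> int list set \<Rightarrow> int list set \<Rightarrow> bool" where
  "is_central_compression k d i S T \<longleftrightarrow>
     T \<subseteq> ZN k d \<and>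
     (\<forall>p \<in> ZN (k - 1) d.
        {x. insert_coord p x i \<in> T} \<approx> {x. insert_coord p x i \<in> S} \<and>
        centrally_compressed i p T)"

definition is_downward_compression ::
    "nat \<Rightarrow> nat \<Rightarrow> nat \<Rightarrow> int list set \<Rightarrow> int list set \<Rightarrow> bool" where
  "is_downward_compression k d j S T \<longleftrightarrow>
     T \<subseteq> ZN k d \<and>
     (\<forall>p \<in> ZN k (d - 1).
        {x. 0 \<le> x \<and> insert_coord p x j \<in> T} \<approx> {x. 0 \<le> x \<and> insert_coord p x j \<in> S} \<and>
        downward_compressed j p T)"

end

theory Submission imports Defs begin

text \<open>
  Fix the direction of compression and cut everything into the lines parallel to it. Two points are
  at distance at most 1 exactly when both their base points and their positions on the lines are,
  so the section of \<open>\<partial>S\<close> over \<open>p\<close> is the union, over the base points \<open>q\<close> close to \<open>p\<close>, of the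
  one-dimensional neighbourhoods \<open>N(S\<^sub>q)\<close> of the sections of \<open>S\<close> (\<open>section_boundary\<close>).

  The sections of a compressed set \<open>T\<close> form a chain under inclusion, and only finitely many \<open>q\<close> are
  close to \<open>p\<close>, so for \<open>T\<close> this union is a single \<open>N(T\<^sub>q)\<close>. Among finite sets of a given size,
  the interval \<open>T\<^sub>q\<close> has the smallest neighbourhood: every non-empty finite set gains at least
  two points in \<open>\<int>\<close> and at least one in \<open>\<nat>\<close>, and compressed sections gain no more than that. Hence
  \<open>|(\<partial>T)\<^sub>p| = |N(T\<^sub>q)| \<le> |N(S\<^sub>q)| \<le> |(\<partial>S)\<^sub>p|\<close>. As the lines partition the space, these injections
  assemble to one of \<open>\<partial>T\<close> into \<open>\<partial>S\<close>, also when the boundaries are infinite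
  (\<open>boundary_lepoll_if_sections\<close>).
\<close>

section \<open>Points at distance at most one\<close>

text \<open>
  Base points are the empty list in dimension one, where \<open>linf_norm\<close> is unspecified; comparing
  coordinatewise makes sense there as well.
\<close>

abbreviation close :: "int list \<Rightarrow> int list \<Rightarrow> bool" where
  "close \<equiv> list_all2 (\<lambda>x y. \<bar>x - y\<bar> \<le> 1)"

lemma linf_norm_diff_le_1_iff_close:
  assumes "length x = length y" "x \<noteq> []"
  shows "linf_norm (map2 (-) x y) \<le> 1 \<longleftrightarrow> close x y"
proof -
  have "linf_norm (map2 (-) x y) \<le> 1 \<longleftrightarrow> (\<forall>z\<in>set (map2 (-) x y). \<bar>z\<bar> \<le> 1)"
    using assms unfolding linf_norm_def by (subst Max_le_iff) auto
  also have "\<dots> \<longleftrightarrow> close x y"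
    using assms by (auto simp: list_all2_iff)
  finally show ?thesis .
qed

lemma finite_close: "finite {q. close p q}"
proof (induction p)
  case (Cons x p)
  have "{q. close (x # p) q} \<subseteq> (\<lambda>(y, q). y # q) ` ({x - 1..x + 1} \<times> {q. close p q})"
    by (fastforce simp: list_all2_Cons1)
  then show ?case
    using Cons by (blast intro: finite_subset finite_imageI finite_cartesian_product
        finite_atLeastAtMost_int)
qed simp

lemma close_insert_coord_iff:
  assumes "length p = length q"
  shows "close (insert_coord p x i) (insert_coord q y i) \<longleftrightarrow> close p q \<and> \<bar>x - y\<bar> \<le> 1"
proof -
  have "close p q \<longleftrightarrow> close (take (i - 1) p @ drop (i - 1) p) (take (i - 1) q @ drop (i - 1) q)"
    by simp
  also have "\<dots> \<longleftrightarrow> close (take (i - 1) p) (take (i - 1) q) \<and> close (drop (i - 1) p) (drop (i - 1) q)"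
    using assms by (intro list_all2_append) simp
  finally have "close p q \<longleftrightarrow> \<dots>" .
  moreover have "close (insert_coord p x i) (insert_coord q y i) \<longleftrightarrow>
      close (take (i - 1) p) (take (i - 1) q) \<and>
      close (x # drop (i - 1) p) (y # drop (i - 1) q)"
    using assms unfolding insert_coord_def by (intro list_all2_append) simp
  ultimately show ?thesis unfolding list.rel_inject(2) by blast
qed

section \<open>Cutting the space into lines\<close>

lemma length_insert_coord [simp]: "length (insert_coord p x i) = Suc (length p)"
  by (simp add: insert_coord_def)

lemma nth_insert_coord:
  assumes "1 \<le> i" "i \<le> Suc (length p)" "j \<le> length p"
  shows "insert_coord p x i ! j =
    (if j < i - 1 then p ! j else if j = i - 1 then x else p ! (j - 1))"
  using assms by (auto simp: insert_coord_def nth_append nth_Cons' min_def)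

lemma insert_coord_eq_iff:
  assumes "length p = length q"
  shows "insert_coord p x i = insert_coord q y i \<longleftrightarrow> p = q \<and> x = y"
proof
  assume "insert_coord p x i = insert_coord q y i"
  then have "take (i - 1) p = take (i - 1) q \<and> drop (i - 1) p = drop (i - 1) q \<and> x = y"
    using assms by (simp add: insert_coord_def append_eq_append_conv)
  then show "p = q \<and> x = y" by (metis append_take_drop_id)
qed simp

lemma insert_coord_remove_nth:
  assumes "1 \<le> i" "i \<le> length z"
  shows "insert_coord (take (i - 1) z @ drop i z) (z ! (i - 1)) i = z"
  using assms id_take_nth_drop[of "i - 1" z, symmetric] by (simp add: insert_coord_def)

text \<open>
  \<open>P\<close> is the set of base points and \<open>D\<close> the line, \<open>\<int>\<close> or \<open>\<nat>\<close>; treating it as a parameter lets both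
  kinds of compression share one argument.
\<close>

definition fibred :: "nat \<Rightarrow> nat \<Rightarrow> nat \<Rightarrow> int list set \<Rightarrow> int set \<Rightarrow> bool" where
  "fibred k d i P D \<longleftrightarrow> (\<forall>p\<in>P. Suc (length p) = k + d) \<and>
     (\<lambda>(p, x). insert_coord p x i) ` (P \<times> D) = ZN k d"

lemma fibredI:
  assumes i: "1 \<le> i" "i \<le> k + d"
    and len: "\<And>p. p \<in> P \<Longrightarrow> Suc (length p) = k + d"
    and mem: "\<And>p x. Suc (length p) = k + d \<Longrightarrow> insert_coord p x i \<in> ZN k d \<longleftrightarrow> p \<in> P \<and> x \<in> D"
  shows "fibred k d i P D"
proof -
  have "z \<in> (\<lambda>(p, x). insert_coord p x i) ` (P \<times> D)" if z: "z \<in> ZN k d" for z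
  proof -
    let ?p = "take (i - 1) z @ drop i z"
    have lz: "length z = k + d" using z by (simp add: ZN_def)
    have eq: "insert_coord ?p (z ! (i - 1)) i = z"
      using i lz by (intro insert_coord_remove_nth) auto
    have "Suc (length ?p) = k + d" using i lz by auto
    then have "?p \<in> P" "z ! (i - 1) \<in> D" using mem[of ?p "z ! (i - 1)"] z eq by auto
    then show ?thesis using eq by force
  qed
  then show ?thesis using len mem by (auto simp: fibred_def)
qed

lemma fibred_integer_coordinate:
  assumes "1 \<le> i" "i \<le> k"
  shows "fibred k d i (ZN (k - 1) d) UNIV"
proof (rule fibredI)
  fix p :: "int list" and x assume len: "Suc (length p) = k + d"
  have "(\<forall>j. k \<le> j \<and> j < k + d \<longrightarrow> 0 \<le> insert_coord p x i ! j) \<longleftrightarrow>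
      (\<forall>j. k \<le> j \<and> j < k + d \<longrightarrow> 0 \<le> p ! (j - 1))"
  proof -
    have "insert_coord p x i ! j = p ! (j - 1)" if "k \<le> j" "j < k + d" for j
    proof -
      have "insert_coord p x i ! j =
          (if j < i - 1 then p ! j else if j = i - 1 then x else p ! (j - 1))"
        using assms len that by (intro nth_insert_coord) linarith+
      moreover have "\<not> j < i - 1" "j \<noteq> i - 1" using assms that by linarith+
      ultimately show ?thesis by simp
    qed
    then show ?thesis by simp
  qed
  also have "\<dots> \<longleftrightarrow> (\<forall>j. k - 1 \<le> j \<and> j < k - 1 + d \<longrightarrow> 0 \<le> p ! j)"
  proof safe
    fix j assume H: "\<forall>j. k \<le> j \<and> j < k + d \<longrightarrow> 0 \<le> p ! (j - 1)" "k - 1 \<le> j" "j < k - 1 + d"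
    then have "k \<le> Suc j" "Suc j < k + d" using assms by linarith+
    then show "0 \<le> p ! j" using H(1)[rule_format, of "Suc j"] by simp
  next
    fix j assume H: "\<forall>j. k - 1 \<le> j \<and> j < k - 1 + d \<longrightarrow> 0 \<le> p ! j" "k \<le> j" "j < k + d"
    then have "k - 1 \<le> j - 1" "j - 1 < k - 1 + d" using assms by linarith+
    then show "0 \<le> p ! (j - 1)" using H(1)[rule_format, of "j - 1"] by simp
  qed
  finally show "insert_coord p x i \<in> ZN k d \<longleftrightarrow> p \<in> ZN (k - 1) d \<and> x \<in> UNIV"
    using assms len by (auto simp: ZN_def)
qed (use assms in \<open>auto simp: ZN_def\<close>)

lemma fibred_natural_coordinate:
  assumes "k + 1 \<le> i" "i \<le> k + d"
  shows "fibred k d i (ZN k (d - 1)) {0..}"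
proof (rule fibredI)
  fix p :: "int list" and x assume len: "Suc (length p) = k + d"
  have nth: "insert_coord p x i ! j =
      (if j < i - 1 then p ! j else if j = i - 1 then x else p ! (j - 1))" if "j < k + d" for j
    using assms len that by (intro nth_insert_coord) auto
  have "(\<forall>j. k \<le> j \<and> j < k + d \<longrightarrow> 0 \<le> insert_coord p x i ! j) \<longleftrightarrow>
      (\<forall>j. k \<le> j \<and> j < k + (d - 1) \<longrightarrow> 0 \<le> p ! j) \<and> 0 \<le> x" (is "?L \<longleftrightarrow> ?R")
  proof
    assume L: ?L
    have "0 \<le> p ! j" if "k \<le> j" "j < k + (d - 1)" for j
    proof (cases "j < i - 1")
      case True
      then show ?thesis using L[rule_format, of j] nth[of j] that by simp
    next
      case False
      then show ?thesis using L[rule_format, of "Suc j"] nth[of "Suc j"] that assms by simp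
    qed
    moreover have "0 \<le> x"
    proof -
      have "k \<le> i - 1" "i - 1 < k + d" using assms by linarith+
      then show ?thesis using L[rule_format, of "i - 1"] nth[of "i - 1"] by simp
    qed
    ultimately show ?R by blast
  next
    assume R: ?R
    show ?L
    proof (intro allI impI)
      fix j assume j: "k \<le> j \<and> j < k + d"
      consider "j < i - 1" | "j = i - 1" | "i - 1 < j" by linarith
      then show "0 \<le> insert_coord p x i ! j"
      proof cases
        case 3
        then have "k \<le> j - 1" "j - 1 < k + (d - 1)" using assms j by linarith+
        then show ?thesis using R nth[of j] j 3 by simp
      qed (use R assms j in \<open>auto simp: nth\<close>)
    qed
  qed
  then show "insert_coord p x i \<in> ZN k d \<longleftrightarrow> p \<in> ZN k (d - 1) \<and> x \<in> {0..}"
    using assms len by (auto simp: ZN_def)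
qed (use assms in \<open>auto simp: ZN_def\<close>)

definition sect :: "int set \<Rightarrow> nat \<Rightarrow> int list set \<Rightarrow> int list \<Rightarrow> int set" where
  "sect D i S p = {x \<in> D. insert_coord p x i \<in> S}"

definition nbhd :: "int set \<Rightarrow> int set \<Rightarrow> int set" where
  "nbhd D A = {x \<in> D. \<exists>y\<in>A. \<bar>x - y\<bar> \<le> 1}"

lemma nbhd_mono: "A \<subseteq> B \<Longrightarrow> nbhd D A \<subseteq> nbhd D B"
  by (auto simp: nbhd_def)

lemma eqpoll_Sigma_sect:
  assumes fib: "fibred k d i P D" and "U \<subseteq> ZN k d"
  shows "U \<approx> (SIGMA p:P. sect D i U p)"
proof -
  have "inj_on (\<lambda>(p, x). insert_coord p x i) (SIGMA p:P. sect D i U p)"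
  proof (intro inj_onI, clarify)
    fix p x q y assume "p \<in> P" "q \<in> P" and eq: "insert_coord p x i = insert_coord q y i"
    then have "length p = length q" using fib by (metis fibred_def nat.inject)
    with eq show "p = q \<and> x = y" by (simp add: insert_coord_eq_iff)
  qed
  moreover have "(\<lambda>(p, x). insert_coord p x i) ` (SIGMA p:P. sect D i U p) = U"
  proof
    show "U \<subseteq> (\<lambda>(p, x). insert_coord p x i) ` (SIGMA p:P. sect D i U p)"
    proof
      fix u assume "u \<in> U"
      with assms have "u \<in> (\<lambda>(p, x). insert_coord p x i) ` (P \<times> D)" by (auto simp: fibred_def)
      then obtain p x where "p \<in> P" "x \<in> D" "u = insert_coord p x i" by auto
      then show "u \<in> (\<lambda>(p, x). insert_coord p x i) ` (SIGMA p:P. sect D i U p)"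
        using \<open>u \<in> U\<close> by (force simp: sect_def)
    qed
  qed (auto simp: sect_def)
  ultimately show ?thesis
    unfolding eqpoll_def by (metis bij_betw_def bij_betw_inv_into)
qed

text \<open>The unit ball of the maximum norm is a product, so it splits along the chosen direction.\<close>

lemma section_boundary:
  assumes fib: "fibred k d i P D" and S: "S \<subseteq> ZN k d" and p: "p \<in> P"
  shows "sect D i (boundary k d S) p = (\<Union>q\<in>{q \<in> P. close p q}. nbhd D (sect D i S q))"
proof -
  have len: "Suc (length q) = k + d" if "q \<in> P" for q using fib that by (simp add: fibred_def)
  have near: "linf_norm (map2 (-) (insert_coord p x i) (insert_coord q y i)) \<le> 1 \<longleftrightarrow>
      close p q \<and> \<bar>x - y\<bar> \<le> 1" if q: "q \<in> P" for q x y
  proof -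
    have lpq: "length p = length q" using len[OF p] len[OF q] by simp
    have "insert_coord p x i \<noteq> []" by (metis length_0_conv length_insert_coord nat.distinct(1))
    then show ?thesis
      using lpq by (simp add: linf_norm_diff_le_1_iff_close close_insert_coord_iff)
  qed
  have "x \<in> sect D i (boundary k d S) p \<longleftrightarrow>
      (\<exists>q\<in>P. close p q \<and> x \<in> nbhd D (sect D i S q))" for x
  proof -
    have "x \<in> sect D i (boundary k d S) p \<longleftrightarrow>
        x \<in> D \<and> (\<exists>z\<in>S. linf_norm (map2 (-) (insert_coord p x i) z) \<le> 1)"
      using fib p by (auto simp: sect_def boundary_def fibred_def)
    also have "\<dots> \<longleftrightarrow> x \<in> D \<and> (\<exists>q\<in>P. \<exists>y\<in>D. insert_coord q y i \<in> S \<and>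
        linf_norm (map2 (-) (insert_coord p x i) (insert_coord q y i)) \<le> 1)"
    proof -
      have "S \<subseteq> (\<lambda>(p, x). insert_coord p x i) ` (P \<times> D)"
        using fib S by (simp add: fibred_def)
      then show ?thesis by fastforce
    qed
    also have "\<dots> \<longleftrightarrow> (\<exists>q\<in>P. close p q \<and> x \<in> nbhd D (sect D i S q))"
      using near by (auto simp: nbhd_def sect_def)
    finally show ?thesis .
  qed
  then show ?thesis by auto
qed

lemma finite_chain_has_largest:
  assumes "finite Q" "Q \<noteq> {}"
    and "\<And>q r. q \<in> Q \<Longrightarrow> r \<in> Q \<Longrightarrow> f q \<subseteq> f r \<or> f r \<subseteq> f q"
  shows "\<exists>q\<in>Q. \<forall>r\<in>Q. f r \<subseteq> f q"
  using assms
proof (induction Q rule: finite_ne_induct)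
  case (insert x F)
  then obtain q where "q \<in> F" "\<forall>r\<in>F. f r \<subseteq> f q" by auto
  then show ?case using insert.prems[of x q] by (metis insert_iff order_refl order_trans)
qed simp

text \<open>
  The neighbourhood of a point is finite, so the chain hypothesis turns the union describing
  \<open>(\<partial>T)\<^sub>p\<close> into its largest member.
\<close>

lemma boundary_lepoll_if_sections:
  assumes fib: "fibred k d i P D" and S: "S \<subseteq> ZN k d" and T: "T \<subseteq> ZN k d"
    and chain: "\<And>q r. q \<in> P \<Longrightarrow> r \<in> P \<Longrightarrow> sect D i T q \<subseteq> sect D i T r \<or> sect D i T r \<subseteq> sect D i T q"
    and le: "\<And>q. q \<in> P \<Longrightarrow> nbhd D (sect D i T q) \<lesssim> nbhd D (sect D i S q)"
  shows "boundary k d T \<lesssim> boundary k d S"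
proof -
  have sec: "sect D i (boundary k d T) p \<lesssim> sect D i (boundary k d S) p" if p: "p \<in> P" for p
  proof -
    let ?Q = "{q \<in> P. close p q}"
    have "p \<in> ?Q" using p by (auto intro: list.rel_refl)
    moreover have "finite ?Q" using finite_close[of p] by (rule rev_finite_subset) auto
    ultimately obtain q where q: "q \<in> ?Q" "\<forall>r\<in>?Q. sect D i T r \<subseteq> sect D i T q"
      using finite_chain_has_largest[of ?Q "sect D i T"] chain by blast
    have "sect D i (boundary k d T) p \<subseteq> nbhd D (sect D i T q)"
      using q(2) nbhd_mono unfolding section_boundary[OF fib T p] by blast
    moreover have "nbhd D (sect D i T q) \<lesssim> nbhd D (sect D i S q)" using le q by simp
    moreover have "nbhd D (sect D i S q) \<subseteq> sect D i (boundary k d S) p"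
      using q(1) unfolding section_boundary[OF fib S p] by blast
    ultimately show ?thesis by (meson lepoll_trans subset_imp_lepoll)
  qed
  have sub: "boundary k d U \<subseteq> ZN k d" for U by (auto simp: boundary_def)
  have "boundary k d T \<lesssim> (SIGMA p:P. sect D i (boundary k d T) p)"
    by (rule eqpoll_imp_lepoll[OF eqpoll_Sigma_sect[OF fib sub]])
  also have "\<dots> \<lesssim> (SIGMA p:P. sect D i (boundary k d S) p)"
    using sec by (intro Sigma_lepoll_mono) auto
  also have "\<dots> \<lesssim> boundary k d S"
    by (rule eqpoll_imp_lepoll[OF eqpoll_sym[OF eqpoll_Sigma_sect[OF fib sub]]])
  finally show ?thesis .
qed

section \<open>Neighbourhoods on a line\<close>

lemma finite_nbhd:
  assumes "finite A" shows "finite (nbhd D A)"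
proof (rule finite_subset)
  show "nbhd D A \<subseteq> (\<Union>y\<in>A. {y - 1..y + 1})"
    unfolding nbhd_def by (force simp: abs_le_iff)
qed (use assms in auto)

text \<open>
  The two new points are the ones just outside the extremes; in \<open>\<nat>\<close> below, the lower one may be
  \<open>-1\<close> and then is lost, so only one gain is guaranteed.
\<close>

lemma card_nbhd_UNIV_ge:
  assumes "finite A" "A \<noteq> {}"
  shows "card A + 2 \<le> card (nbhd UNIV A)"
proof -
  let ?l = "Min A - 1" and ?u = "Max A + 1"
  have "?l \<notin> A" "?u \<notin> A" "?l \<noteq> ?u"
    using assms Min_le[of A ?l] Max_ge[of A ?u] Min_le[of A "Max A"] Max_in[of A] by linarith+
  then have "card (insert ?l (insert ?u A)) = card A + 2" using assms by simp
  moreover have "insert ?l (insert ?u A) \<subseteq> nbhd UNIV A"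
  proof -
    have "Min A \<in> A" "Max A \<in> A" using assms by auto
    then show ?thesis by (force simp: nbhd_def)
  qed
  ultimately show ?thesis using card_mono[OF finite_nbhd[OF assms(1)]] by metis
qed

lemma card_nbhd_nonneg_ge:
  assumes "finite A" "A \<noteq> {}" "A \<subseteq> {0..}"
  shows "card A + 1 \<le> card (nbhd {0..} A)"
proof -
  let ?u = "Max A + 1"
  have "?u \<notin> A" using assms Max_ge[of A ?u] by auto
  then have "card (insert ?u A) = card A + 1" using assms by simp
  moreover have "insert ?u A \<subseteq> nbhd {0..} A"
  proof -
    have "Max A \<in> A" using assms by auto
    then show ?thesis using assms(3) by (force simp: nbhd_def)
  qed
  ultimately show ?thesis using card_mono[OF finite_nbhd[OF assms(1)]] by metis
qed

lemma nbhd_UNIV_lepoll_if_interval: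
  assumes "{l..u} \<approx> A" "l \<le> u"
  shows "nbhd UNIV {l..u} \<lesssim> nbhd UNIV A"
proof -
  have fin: "finite A" using assms(1) eqpoll_finite_iff by blast
  have ne: "A \<noteq> {}" using assms by auto
  have "nbhd UNIV {l..u} \<subseteq> {l - 1..u + 1}" by (auto simp: nbhd_def)
  then have "card (nbhd UNIV {l..u}) \<le> card {l - 1..u + 1}" by (intro card_mono) auto
  also have "\<dots> = card {l..u} + 2" using assms(2) by simp
  also have "\<dots> = card A + 2" using assms(1) fin by (simp add: eqpoll_iff_card)
  also have "\<dots> \<le> card (nbhd UNIV A)" using fin ne by (rule card_nbhd_UNIV_ge)
  finally show ?thesis using fin by (simp add: lepoll_iff_card_le finite_nbhd)
qed

lemma nbhd_nonneg_lepoll_if_initial_segment: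
  assumes "{0..u} \<approx> A" "0 \<le> u" "A \<subseteq> {0..}"
  shows "nbhd {0..} {0..u} \<lesssim> nbhd {0..} A"
proof -
  have fin: "finite A" using assms(1) eqpoll_finite_iff by blast
  have ne: "A \<noteq> {}" using assms by auto
  have "nbhd {0..} {0..u} \<subseteq> {0..u + 1}" by (auto simp: nbhd_def)
  then have "card (nbhd {0..} {0..u}) \<le> card {0..u + 1}" by (intro card_mono) auto
  also have "\<dots> = card {0..u} + 1" using assms(2) by simp
  also have "\<dots> = card A + 1" using assms(1) fin by (simp add: eqpoll_iff_card)
  also have "\<dots> \<le> card (nbhd {0..} A)" using fin ne assms(3) by (rule card_nbhd_nonneg_ge)
  finally show ?thesis using fin by (simp add: lepoll_iff_card_le finite_nbhd)
qed

section \<open>Compression does not enlarge the boundary\<close>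

text \<open>
  The admissible sections are the members of the single chain
  \<open>{} \<subset> {0} \<subset> {0, 1} \<subset> {-1, 0, 1} \<subset> {-1, 0, 1, 2} \<subset> \<dots>\<close>, which is why sections over different
  base points are comparable.
\<close>

lemma central_compression_boundary:
  assumes "1 \<le> i" "i \<le> k" and S: "S \<subseteq> ZN k d" and "is_central_compression k d i S T"
  shows "boundary k d T \<lesssim> boundary k d S"
proof (rule boundary_lepoll_if_sections)
  show "fibred k d i (ZN (k - 1) d) UNIV" using assms by (intro fibred_integer_coordinate)
  show "T \<subseteq> ZN k d" using assms by (simp add: is_central_compression_def)
  have shape: "sect UNIV i T q = {} \<or> (\<exists>a\<ge>0. sect UNIV i T q = {- a..a}) \<or>
        (\<exists>a\<ge>0. sect UNIV i T q = {- a..a + 1})"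
    and size: "sect UNIV i T q \<approx> sect UNIV i S q" if "q \<in> ZN (k - 1) d" for q
    using assms that
    by (auto simp: is_central_compression_def centrally_compressed_def sect_def)
  show "sect UNIV i T q \<subseteq> sect UNIV i T r \<or> sect UNIV i T r \<subseteq> sect UNIV i T q"
    if "q \<in> ZN (k - 1) d" "r \<in> ZN (k - 1) d" for q r
    using shape[OF that(1)] shape[OF that(2)] by (elim disjE exE conjE) auto
  show "nbhd UNIV (sect UNIV i T q) \<lesssim> nbhd UNIV (sect UNIV i S q)"
    if q: "q \<in> ZN (k - 1) d" for q
    using shape[OF q]
  proof (elim disjE exE conjE)
    assume "sect UNIV i T q = {}"
    then show ?thesis by (simp add: nbhd_def)
  next
    fix a :: int assume "0 \<le> a" "sect UNIV i T q = {- a..a}"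
    then show ?thesis using size[OF q] nbhd_UNIV_lepoll_if_interval[of "- a" a] by simp
  next
    fix a :: int assume "0 \<le> a" "sect UNIV i T q = {- a..a + 1}"
    then show ?thesis using size[OF q] nbhd_UNIV_lepoll_if_interval[of "- a" "a + 1"] by simp
  qed
qed (use S in auto)

lemma downward_compression_boundary:
  assumes "k + 1 \<le> j" "j \<le> k + d" and S: "S \<subseteq> ZN k d" and "is_downward_compression k d j S T"
  shows "boundary k d T \<lesssim> boundary k d S"
proof (rule boundary_lepoll_if_sections)
  show "fibred k d j (ZN k (d - 1)) {0..}" using assms by (intro fibred_natural_coordinate)
  show "T \<subseteq> ZN k d" using assms by (simp add: is_downward_compression_def)
  have shape: "sect {0..} j T q = {} \<or> (\<exists>a\<ge>0. sect {0..} j T q = {0..a})"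
    and size: "sect {0..} j T q \<approx> sect {0..} j S q" if "q \<in> ZN k (d - 1)" for q
    using assms that
    by (auto simp: is_downward_compression_def downward_compressed_def sect_def)
  show "sect {0..} j T q \<subseteq> sect {0..} j T r \<or> sect {0..} j T r \<subseteq> sect {0..} j T q"
    if "q \<in> ZN k (d - 1)" "r \<in> ZN k (d - 1)" for q r
    using shape[OF that(1)] shape[OF that(2)] by (elim disjE exE conjE) auto
  show "nbhd {0..} (sect {0..} j T q) \<lesssim> nbhd {0..} (sect {0..} j S q)"
    if q: "q \<in> ZN k (d - 1)" for q
    using shape[OF q]
  proof (elim disjE exE conjE)
    assume "sect {0..} j T q = {}"
    then show ?thesis by (simp add: nbhd_def)
  next
    fix a :: int assume a: "0 \<le> a" "sect {0..} j T q = {0..a}"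
    have "sect {0..} j S q \<subseteq> {0..}" by (auto simp: sect_def)
    then show ?thesis
      using size[OF q] a nbhd_nonneg_lepoll_if_initial_segment[of a "sect {0..} j S q"] by simp
  qed
qed (use S in auto)

theorem proposition1:
  fixes k d :: nat and S :: "int list set"
  assumes "\<not> (k = 0 \<and> d = 0)"
    and "S \<subseteq> ZN k d"
  shows "(\<forall>i T. 1 \<le> i \<and> i \<le> k \<and> is_central_compression k d i S T
            \<longrightarrow> boundary k d T \<lesssim> boundary k d S) \<and>
         (\<forall>j T. k + 1 \<le> j \<and> j \<le> k + d \<and> is_downward_compression k d j S T
            \<longrightarrow> boundary k d T \<lesssim> boundary k d S)"
  using central_compression_boundary downward_compression_boundary assms(2) by blast

end
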